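(* There are infinitely many minimal obstructions to list 3-coloring $\{P_8,C_3\}$-free graphs; that is, there are infinitely many minimal obstructions $(G,L)$ to list 3-coloring in which $G$ is $\{P_8,C_3\}$-free.
   Context: All graphs are finite, simple, loopless and undirected. $P_t$ denotes the path on $t$ vertices and $C_\ell$ the cycle on $\ell$ vertices. For a set $\mathcal H$ of graphs, a graph is $\mathcal H$-free if no member of $\mathcal H$ is (isomorphic to) an induced subgraph of it. A list 3-coloring instance is a pair $(G,L)$ with $L(v)\subseteq\{1,2,3\}$ for each $v\in V(G)$; it is colorable if there is a function $f$ on $V(G)$ with $f(v)\in L(v)$ for all $v$ and $f(v)\ne f(w)$ for every edge $vw$. A list 3-coloring instance $(G,L)$ is a minimal obstruction to list 3-coloring if $(G,L)$ is not colorable but for every proper induced subgraph $H$ of $G$ the instance $(H,L|_{V(H)})$ is colorable, where $L|_{V(H)}$ is the restriction of $L$ to $V(H)$. Obstructions are counted up to list-preserving isomorphism. *)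

theory Defs
  imports
    "HOL-Library.FuncSet"
    "Graph_Theory.Pair_Digraph"
    "Graph_Theory.Digraph_Isomorphism"
begin

text \<open>
  A finite simple loopless undirected graph is a \<^locale>\<open>pair_graph\<close>: a finite vertex set with a
  symmetric, irreflexive set of arcs, each edge being represented by its two orientations.
\<close>

definition path_graph :: "nat \<Rightarrow> nat pair_pre_digraph" where
  "path_graph t = \<lparr> pverts = {..<t},
     parcs = {(i, j). i < t \<and> j < t \<and> (j = Suc i \<or> i = Suc j)} \<rparr>"

text \<open>Meaningful for \<open>l \<ge> 3\<close> only.\<close>

definition cycle_graph :: "nat \<Rightarrow> nat pair_pre_digraph" where
  "cycle_graph l = \<lparr> pverts = {..<l},
     parcs = {(i, j). i < l \<and> j < l \<and> (j = Suc i mod l \<or> i = Suc j mod l)} \<rparr>"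

definition graph_free :: "'b pair_pre_digraph set \<Rightarrow> 'a pair_pre_digraph \<Rightarrow> bool" where
  "graph_free \<H> G \<longleftrightarrow>
     \<not> (\<exists>H\<in>\<H>. \<exists>K :: 'a pair_pre_digraph.
          induced_subgraph (with_proj K) (with_proj G) \<and> digraph_iso (with_proj H) (with_proj K))"

text \<open>
  The list assignment is extensional, i.e. it is \<^const>\<open>undefined\<close> outside the vertex set, so that
  it is determined by its values on the vertices.
\<close>

definition list3_instance :: "'a pair_pre_digraph \<Rightarrow> ('a \<Rightarrow> nat set) \<Rightarrow> bool" where
  "list3_instance G L \<longleftrightarrow> pair_graph G \<and> L \<in> pverts G \<rightarrow>\<^sub>E Pow {1, 2, 3}"

definition list_colorable :: "'a pair_pre_digraph \<Rightarrow> ('a \<Rightarrow> nat set) \<Rightarrow> bool" where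
  "list_colorable G L \<longleftrightarrow>
     (\<exists>f. (\<forall>v\<in>pverts G. f v \<in> L v) \<and> (\<forall>(v, w)\<in>parcs G. f v \<noteq> f w))"

definition minimal_list3_obstruction :: "'a pair_pre_digraph \<Rightarrow> ('a \<Rightarrow> nat set) \<Rightarrow> bool" where
  "minimal_list3_obstruction G L \<longleftrightarrow>
     list3_instance G L \<and> \<not> list_colorable G L \<and>
     (\<forall>H. induced_subgraph (with_proj H) (with_proj G) \<and> H \<noteq> G \<longrightarrow>
        list_colorable H (restrict L (pverts H)))"

definition list3_iso ::
  "('a pair_pre_digraph \<times> ('a \<Rightarrow> nat set)) rel" where
  "list3_iso = {((G, L), (G', L')). list3_instance G L \<and> list3_instance G' L' \<and>
     (\<exists>hom. pre_digraph.digraph_isomorphism (with_proj G) hom \<and>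
        with_proj G' = app_iso hom (with_proj G) \<and>
        (\<forall>v\<in>pverts G. L' (iso_verts hom v) = L v))}"

text \<open>
  Elementary descriptions of the notions above in terms of vertex maps; in particular, list
  isomorphism is an equivalence relation on list instances.
\<close>

lemma with_proj_app_isoI:
  assumes "pair_wf_digraph G" "inj_on f (pverts G)"
    and "pverts G' = f ` pverts G" "parcs G' = map_prod f f ` parcs G"
  defines "hom \<equiv> \<lparr> iso_verts = f, iso_arcs = map_prod f f, iso_head = snd, iso_tail = fst \<rparr>"
  shows "pre_digraph.digraph_isomorphism (with_proj G) hom"
    and "with_proj G' = app_iso hom (with_proj G)"
proof -
  interpret pair_wf_digraph G by fact
  have "parcs G \<subseteq> pverts G \<times> pverts G"
    using in_arcsD1 in_arcsD2 by auto
  then have "inj_on (map_prod f f) (parcs G)"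
    using assms(2) unfolding inj_on_def by auto blast+
  then show "pre_digraph.digraph_isomorphism (with_proj G) hom"
    using assms(1,2) by (simp add: pre_digraph.digraph_isomorphism_def wf_digraph_wp_iff hom_def)
  show "with_proj G' = app_iso hom (with_proj G)"
    using assms(3,4) by (simp add: app_iso_def with_proj_def hom_def)
qed

lemma with_proj_app_isoD:
  assumes "pre_digraph.digraph_isomorphism (with_proj G) hom"
    and "with_proj G' = app_iso hom (with_proj G)"
  shows "pair_wf_digraph G" "inj_on (iso_verts hom) (pverts G)"
    "pverts G' = iso_verts hom ` pverts G"
    "parcs G' = map_prod (iso_verts hom) (iso_verts hom) ` parcs G"
proof -
  from assms(2) have eqs: "pverts G' = iso_verts hom ` pverts G" "parcs G' = iso_arcs hom ` parcs G"
    "iso_tail hom = fst" "iso_head hom = snd"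
    by (simp_all add: app_iso_def with_proj_def)
  show "pair_wf_digraph G" "inj_on (iso_verts hom) (pverts G)"
    using assms(1) by (auto simp: pre_digraph.digraph_isomorphism_def wf_digraph_wp_iff)
  show "pverts G' = iso_verts hom ` pverts G" by (rule eqs)
  have "iso_arcs hom a = map_prod (iso_verts hom) (iso_verts hom) a" if "a \<in> parcs G" for a
    using assms(1) that eqs(3,4)
    by (auto simp: pre_digraph.digraph_isomorphism_def prod_eq_iff)
  then show "parcs G' = map_prod (iso_verts hom) (iso_verts hom) ` parcs G"
    unfolding eqs(2) by (rule image_cong[OF refl])
qed

lemma list3_iso_iff:
  "((G, L), (G', L')) \<in> list3_iso \<longleftrightarrow> list3_instance G L \<and> list3_instance G' L' \<and>
     (\<exists>f. inj_on f (pverts G) \<and> pverts G' = f ` pverts G \<and>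
        parcs G' = map_prod f f ` parcs G \<and> (\<forall>v\<in>pverts G. L' (f v) = L v))"
  (is "?l \<longleftrightarrow> ?i \<and> ?i' \<and> (\<exists>f. ?P f)")
proof
  assume ?l
  then obtain hom where "?i" "?i'" "pre_digraph.digraph_isomorphism (with_proj G) hom"
    "with_proj G' = app_iso hom (with_proj G)" "\<forall>v\<in>pverts G. L' (iso_verts hom v) = L v"
    unfolding list3_iso_def by auto
  then show "?i \<and> ?i' \<and> (\<exists>f. ?P f)"
    using with_proj_app_isoD(2-4)[of G hom G'] by (intro conjI exI[of _ "iso_verts hom"]) simp_all
next
  assume "?i \<and> ?i' \<and> (\<exists>f. ?P f)"
  then obtain f where i: "?i" "?i'" and f: "?P f" by blast
  have "pair_wf_digraph G"
    using i(1) unfolding list3_instance_def pair_graph_def pair_digraph_def pair_fin_digraph_def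
    by blast
  from with_proj_app_isoI[OF this, of f G'] show ?l
    unfolding list3_iso_def using i f by (auto intro!: exI)
qed

lemma equiv_list3_iso:
  "equiv {(G, L). list3_instance G L} (list3_iso :: ('a pair_pre_digraph \<times> ('a \<Rightarrow> nat set)) rel)"
  (is "equiv ?A ?r")
proof (rule equivI)
  show "?r \<subseteq> ?A \<times> ?A"
    by (auto simp: list3_iso_def)
  show "refl_on ?A ?r"
    by (rule refl_onI) (auto simp: list3_iso_iff map_prod.id intro!: exI[of _ id])
  show "sym ?r"
  proof (rule symI, clarify)
    fix G G' :: "'a pair_pre_digraph" and L L'
    assume "((G, L), (G', L')) \<in> list3_iso"
    then obtain f where i: "list3_instance G L" "list3_instance G' L'" and f: "inj_on f (pverts G)"
      "pverts G' = f ` pverts G" "parcs G' = map_prod f f ` parcs G" "\<forall>v\<in>pverts G. L' (f v) = L v"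
      unfolding list3_iso_iff by blast
    let ?g = "the_inv_into (pverts G) f"
    have g: "?g (f v) = v" if "v \<in> pverts G" for v
      using f(1) that by (rule the_inv_into_f_f)
    have wf: "pair_wf_digraph G"
      using i(1) unfolding list3_instance_def pair_graph_def pair_digraph_def pair_fin_digraph_def
      by blast
    have "map_prod ?g ?g (map_prod f f e) = e" if "e \<in> parcs G" for e
      using g pair_wf_digraph.arc_fst_in_verts[OF wf that] pair_wf_digraph.arc_snd_in_verts[OF wf that]
      by (simp add: prod_eq_iff)
    then have "parcs G = map_prod ?g ?g ` parcs G'"
      unfolding f(3) image_image by simp
    moreover have "pverts G = ?g ` pverts G'"
      unfolding f(2) image_image using g by simp
    moreover have "inj_on ?g (pverts G')"
      unfolding f(2) using f(1) by (rule inj_on_the_inv_into)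
    moreover have "\<forall>v\<in>pverts G'. L (?g v) = L' v"
      unfolding f(2) using g f(4) by simp
    ultimately show "((G', L'), (G, L)) \<in> list3_iso"
      unfolding list3_iso_iff using i by blast
  qed
  show "trans ?r"
  proof (rule transI, clarify)
    fix G1 G2 G3 :: "'a pair_pre_digraph" and L1 L2 L3
    assume "((G1, L1), (G2, L2)) \<in> list3_iso" "((G2, L2), (G3, L3)) \<in> list3_iso"
    then obtain f g where i: "list3_instance G1 L1" "list3_instance G3 L3"
      and f: "inj_on f (pverts G1)" "pverts G2 = f ` pverts G1" "parcs G2 = map_prod f f ` parcs G1"
        "\<forall>v\<in>pverts G1. L2 (f v) = L1 v"
      and g: "inj_on g (pverts G2)" "pverts G3 = g ` pverts G2" "parcs G3 = map_prod g g ` parcs G2"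
        "\<forall>v\<in>pverts G2. L3 (g v) = L2 v"
      unfolding list3_iso_iff by (elim conjE exE)
    have "inj_on (g \<circ> f) (pverts G1)"
      using f g by (auto intro: comp_inj_on)
    moreover have "parcs G3 = map_prod (g \<circ> f) (g \<circ> f) ` parcs G1"
      unfolding g(3) f(3) image_image by (rule image_cong) auto
    moreover have "pverts G3 = (g \<circ> f) ` pverts G1" "\<forall>v\<in>pverts G1. L3 ((g \<circ> f) v) = L1 v"
      using f(2,4) g(2,4) by auto
    ultimately show "((G1, L1), (G3, L3)) \<in> list3_iso"
      unfolding list3_iso_iff using i by (intro conjI exI[of _ "g \<circ> f"])
  qed
qed

lemma pair_graph_path_graph: "pair_graph (path_graph t)"
proof -
  have "finite (parcs (path_graph t))"
    by (rule finite_subset[of _ "{..<t} \<times> {..<t}"]) (auto simp: path_graph_def)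
  then show ?thesis
    by unfold_locales (auto simp: path_graph_def symmetric_def intro!: symI)
qed

lemma pair_graph_cycle_graph:
  assumes "l \<ge> 3"
  shows "pair_graph (cycle_graph l)"
proof -
  have "finite (parcs (cycle_graph l))"
    by (rule finite_subset[of _ "{..<l} \<times> {..<l}"]) (auto simp: cycle_graph_def)
  moreover have "i \<noteq> Suc i mod l" if "i < l" for i
    using assms that by (cases "Suc i = l") auto
  ultimately show ?thesis
    by unfold_locales (auto simp: cycle_graph_def symmetric_def intro!: symI dest: sym)
qed

end

theory Submission
  imports Defs
begin

text \<open>
  The obstructions are chains of forced colours. Colour the natural numbers \<open>0, 1, 2, \<dots>\<close>
  cyclically by \<open>1, 2, 3\<close>, join consecutive numbers, and give each number \<open>p\<close> the list consisting of
  the colour of \<open>p - 1\<close> and its own colour. If \<open>0\<close> keeps only its own colour, then along the path every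
  vertex is forced to take its own colour; if the last vertex \<open>n\<close> may only use the colour of \<open>n - 1\<close>,
  there is no colouring. When any vertex \<open>k\<close> is deleted, the vertices below \<open>k\<close> can take their own
  colour and those above \<open>k\<close> the colour of their predecessor, so the instance is minimal.

  A bare path contains long induced paths, so chords are needed, and a chord does no harm as long as
  all these shifted colourings stay proper on it. This leaves many possible chords; the ones used here
  are the pairs \<open>p < q\<close> with \<open>p mod 3 = 0\<close>, \<open>q mod 3 = 2\<close> and \<open>q \<noteq> p + 2\<close>
  (\<open>colour_arc_up\<close>).

  For the excluded subgraphs, write \<open>a\<^sub>i = 3i\<close>, \<open>b\<^sub>i = 3i + 1\<close>, \<open>c\<^sub>i = 3i + 2\<close>. Then
  \<open>b\<^sub>i\<close> is adjacent exactly to \<open>a\<^sub>i\<close> and \<open>c\<^sub>i\<close>, and \<open>a\<^sub>i\<close> is adjacent to \<open>c\<^sub>j\<close> iff \<open>i = j + 1\<close> or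
  \<open>i < j\<close>. In other words, the graph arises from the half graph on the \<open>a\<^sub>i\<close> and \<open>c\<^sub>j\<close>, with edges
  for \<open>i \<le> j + 1\<close>, by subdividing each edge \<open>a\<^sub>i c\<^sub>i\<close> with the middle vertex \<open>b\<^sub>i\<close>. Call the edges of the
  half graph links, and \<open>a\<^sub>i, c\<^sub>i\<close> twins. A triangle would consist of a middle vertex and a pair of
  twins, and twins are not adjacent.

  Now delete the middle vertices from an induced path on eight vertices. Middle vertices are at
  distance at least three on the path, so at least five vertices remain, and consecutive ones are
  linked. The half graph has no two edges without a third edge between them, hence among five
  consecutive remaining vertices the first and fourth, or the second and fifth, are twins
  (\<open>linked_walk_5_twin\<close>), and among six the pairs one-four, two-five and three-six all are
  (\<open>linked_walk_6_twins\<close>). A path vertex next to a middle vertex of the path cannot have its twin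
  further along the path, since the middle vertex would be adjacent to both. So if six vertices
  remain, no middle vertex is near them and the path has only six vertices; seven vertices would
  give one of them two twins; and with five, three middle vertices do not fit.
\<close>

section \<open>Induced copies as vertex maps\<close>

text \<open>
  An induced subgraph together with an isomorphism onto it is an injective vertex map that preserves
  and reflects arcs.
\<close>

lemma graph_freeI:
  fixes G :: "'a pair_pre_digraph"
  assumes "\<And>H f. \<lbrakk>H \<in> \<H>; inj_on f (pverts H); f ` pverts H \<subseteq> pverts G;
      \<And>i j. i \<in> pverts H \<Longrightarrow> j \<in> pverts H \<Longrightarrow> (f i, f j) \<in> parcs G \<longleftrightarrow> (i, j) \<in> parcs H\<rbrakk> \<Longrightarrow> False"
  shows "graph_free \<H> G"
  unfolding graph_free_def
proof clarify
  fix H and K :: "'a pair_pre_digraph"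
  assume "H \<in> \<H>" and ind: "induced_subgraph (with_proj K) (with_proj G)"
    and "digraph_iso (with_proj H) (with_proj K)"
  then obtain hom where hom: "pre_digraph.digraph_isomorphism (with_proj H) hom"
    "with_proj K = app_iso hom (with_proj H)"
    unfolding digraph_iso_def by auto
  define f where "f = iso_verts hom"
  note f = with_proj_app_isoD[OF hom, folded f_def]
  from ind have sub: "pverts K \<subseteq> pverts G"
    and arcs: "parcs K = {e \<in> parcs G. fst e \<in> pverts K \<and> snd e \<in> pverts K}"
    by (auto simp: induced_subgraph_def subgraph_def)
  have "(f i, f j) \<in> parcs G \<longleftrightarrow> (i, j) \<in> parcs H" if "i \<in> pverts H" "j \<in> pverts H" for i j
  proof -
    have "(f i, f j) \<in> parcs G \<longleftrightarrow> (f i, f j) \<in> parcs K"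
      using that arcs f(3) by auto
    also have "\<dots> \<longleftrightarrow> (i, j) \<in> parcs H"
    proof
      assume "(f i, f j) \<in> parcs K"
      then obtain a b where ab: "(a, b) \<in> parcs H" "f i = f a" "f j = f b"
        unfolding f(4) by auto
      then have "a \<in> pverts H" "b \<in> pverts H"
        using pair_wf_digraph.in_arcsD1[OF f(1)] pair_wf_digraph.in_arcsD2[OF f(1)] by auto
      with ab that f(2) show "(i, j) \<in> parcs H"
        by (metis inj_onD)
    qed (auto simp: f(4) intro: image_eqI[of _ _ "(i, j)"])
    finally show ?thesis .
  qed
  with assms[OF \<open>H \<in> \<H>\<close> f(2)] sub f(3) show False by auto
qed

section \<open>The graphs and their lists\<close>

text \<open>
  The adjacencies from a smaller to a larger vertex. The modular condition alone would allow
  \<open>q = p + 2\<close>, which forms a triangle with \<open>p + 1\<close>; the next possible difference is \<open>5\<close>.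
\<close>

definition arc_up :: "nat \<Rightarrow> nat \<Rightarrow> bool" where
  "arc_up p q \<longleftrightarrow> q = Suc p \<or> p mod 3 = 0 \<and> q mod 3 = 2 \<and> p + 5 \<le> q"

definition adj :: "nat \<Rightarrow> nat \<Rightarrow> bool" where
  "adj p q \<longleftrightarrow> arc_up p q \<or> arc_up q p"

definition chain_graph :: "nat \<Rightarrow> nat pair_pre_digraph" where
  "chain_graph n = \<lparr> pverts = {..n}, parcs = {(p, q). p \<le> n \<and> q \<le> n \<and> adj p q} \<rparr>"

definition colour :: "nat \<Rightarrow> nat" where
  "colour p = Suc (p mod 3)"

text \<open>
  The first part is inherited from the predecessor, the second part is the forced colour; vertex \<open>0\<close>
  has no predecessor, and at \<open>n\<close> the forced colour is removed to create the contradiction.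
\<close>

definition chain_list :: "nat \<Rightarrow> nat \<Rightarrow> nat set" where
  "chain_list n = restrict (\<lambda>p. (if p = 0 then {} else {colour (p - 1)}) \<union>
     (if p = n then {} else {colour p})) {..n}"

lemma arc_up_less: "arc_up p q \<Longrightarrow> p < q"
  by (auto simp: arc_up_def)

lemma adj_sym: "adj p q \<longleftrightarrow> adj q p"
  by (auto simp: adj_def)

lemma pair_graph_chain_graph: "pair_graph (chain_graph n)"
proof -
  have "finite (parcs (chain_graph n))"
    by (rule finite_subset[of _ "{..n} \<times> {..n}"]) (auto simp: chain_graph_def)
  then show ?thesis
    by unfold_locales
      (auto simp: chain_graph_def symmetric_def adj_def dest: arc_up_less intro!: symI)
qed

lemma list3_instance_chain: "list3_instance (chain_graph n) (chain_list n)"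
proof -
  have "colour p \<in> {1, 2, 3}" for p
    by (simp add: colour_def) presburger
  then have "chain_list n p \<in> Pow {1, 2, 3}" if "p \<le> n" for p
    using that unfolding chain_list_def by auto
  then show ?thesis
    unfolding list3_instance_def using pair_graph_chain_graph
    by (auto simp: chain_graph_def chain_list_def)
qed

section \<open>Minimality\<close>

lemma not_list_colorable_chain:
  assumes "n \<ge> 1"
  shows "\<not> list_colorable (chain_graph n) (chain_list n)"
proof
  assume "list_colorable (chain_graph n) (chain_list n)"
  then obtain f where f: "\<And>p. p \<le> n \<Longrightarrow> f p \<in> chain_list n p"
    "\<And>p q. p \<le> n \<Longrightarrow> q \<le> n \<Longrightarrow> adj p q \<Longrightarrow> f p \<noteq> f q"
    unfolding list_colorable_def chain_graph_def by auto
  have step: "f p \<noteq> f (Suc p)" if "p < n" for p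
    using that f(2)[of p "Suc p"] by (auto simp: adj_def arc_up_def)
  have forced: "f p = colour p" if "p < n" for p
    using that
  proof (induction p)
    case 0
    with f(1)[of 0] show ?case by (auto simp: chain_list_def)
  next
    case (Suc p)
    with f(1)[of "Suc p"] step[of p] show ?case by (auto simp: chain_list_def split: if_splits)
  qed
  from f(1)[of n] assms have "f n = colour (n - 1)"
    by (auto simp: chain_list_def)
  with forced[of "n - 1"] step[of "n - 1"] assms show False by simp
qed

lemma colour_residue: "colour (3 * i) = 1" "colour (3 * i + 1) = 2" "colour (3 * i + 2) = 3"
  by (simp_all add: colour_def mod_Suc)

lemma colour_Suc_neq: "colour p \<noteq> colour (Suc p)"
  by (simp add: colour_def mod_Suc)

text \<open>
  After deletion of \<open>k\<close>, the ends \<open>p < q\<close> of an edge are both below \<open>k\<close>, both above \<open>k\<close>, or on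
  different sides of \<open>k\<close>; the three claims say that the shifted colouring is proper in these cases. In
  the last one \<open>k\<close> lies strictly between, so the edge is a chord: there \<open>p, q, q - 1, p - 1\<close> have
  colours \<open>1, 3, 2, 3\<close>.
\<close>

lemma colour_arc_up:
  assumes "arc_up p q"
  shows "colour p \<noteq> colour q"
    and "0 < p \<Longrightarrow> colour (p - 1) \<noteq> colour (q - 1)"
    and "q \<noteq> Suc p \<Longrightarrow> colour p \<noteq> colour (q - 1)"
proof -
  have "colour p \<noteq> colour q \<and> (0 < p \<longrightarrow> colour (p - 1) \<noteq> colour (q - 1)) \<and>
      (q \<noteq> Suc p \<longrightarrow> colour p \<noteq> colour (q - 1))"
  proof (cases "q = Suc p")
    case True
    with colour_Suc_neq[of p] colour_Suc_neq[of "p - 1"] show ?thesis by auto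
  next
    case False
    with assms have "p mod 3 = 0" "q mod 3 = 2"
      by (auto simp: arc_up_def)
    then have p: "p = 3 * (p div 3)" and q: "q = 3 * (q div 3) + 2"
      using mult_div_mod_eq[of 3 p] mult_div_mod_eq[of 3 q] by simp_all
    have "q - 1 = 3 * (q div 3) + 1" "0 < p \<longrightarrow> p - 1 = 3 * (p div 3 - 1) + 2"
      using p q by linarith+
    then have "colour p = 1" "colour q = 3" "colour (q - 1) = 2" "0 < p \<longrightarrow> colour (p - 1) = 3"
      using colour_residue p q by metis+
    then show ?thesis by simp
  qed
  then show "colour p \<noteq> colour q" "0 < p \<Longrightarrow> colour (p - 1) \<noteq> colour (q - 1)"
    "q \<noteq> Suc p \<Longrightarrow> colour p \<noteq> colour (q - 1)" by blast+
qed

lemma list_colorable_chain_delete_vertex: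
  assumes H: "induced_subgraph (with_proj H) (with_proj (chain_graph n))" and k: "k \<notin> pverts H" "k \<le> n"
  shows "list_colorable H (restrict (chain_list n) (pverts H))"
proof -
  define f where "f p = (if p < k then colour p else colour (p - 1))" for p
  from H have sub: "pverts H \<subseteq> {..n}"
    and arcs: "parcs H = {e \<in> parcs (chain_graph n). fst e \<in> pverts H \<and> snd e \<in> pverts H}"
    by (auto simp: induced_subgraph_def subgraph_def chain_graph_def)
  have up: "f p \<noteq> f q" if "arc_up p q" "p \<noteq> k" "q \<noteq> k" for p q
    using colour_arc_up[OF that(1)] arc_up_less[OF that(1)] that(2,3) by (auto simp: f_def not_less)
  have "f p \<in> chain_list n p" if "p \<in> pverts H" for p
  proof -
    from that k(1) have "p \<noteq> k" by auto
    then show ?thesis using that sub k(2) by (auto simp: chain_list_def f_def)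
  qed
  moreover have "f p \<noteq> f q" if "(p, q) \<in> parcs H" for p q
  proof -
    from that arcs have "adj p q" "p \<in> pverts H" "q \<in> pverts H"
      by (auto simp: chain_graph_def)
    with k(1) have "p \<noteq> k" "q \<noteq> k" by auto
    with \<open>adj p q\<close> up[of p q] up[of q p] show ?thesis
      unfolding adj_def by metis
  qed
  ultimately show ?thesis
    unfolding list_colorable_def by (intro exI[of _ f]) auto
qed

lemma minimal_list3_obstruction_chain:
  assumes "n \<ge> 1"
  shows "minimal_list3_obstruction (chain_graph n) (chain_list n)"
  unfolding minimal_list3_obstruction_def
proof (intro conjI allI impI)
  show "list3_instance (chain_graph n) (chain_list n)"
    by (rule list3_instance_chain)
  show "\<not> list_colorable (chain_graph n) (chain_list n)"
    using assms by (rule not_list_colorable_chain)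
  fix H
  assume H: "induced_subgraph (with_proj H) (with_proj (chain_graph n)) \<and> H \<noteq> chain_graph n"
  then have ind: "induced_subgraph (with_proj H) (with_proj (chain_graph n))" by blast
  then have sub: "pverts H \<subseteq> {..n}"
    and arcs: "parcs H = {e \<in> parcs (chain_graph n). fst e \<in> pverts H \<and> snd e \<in> pverts H}"
    by (auto simp: induced_subgraph_def subgraph_def chain_graph_def)
  have "pverts H \<noteq> {..n}"
  proof
    assume eq: "pverts H = {..n}"
    have "parcs H = parcs (chain_graph n)"
      unfolding arcs eq by (auto simp: chain_graph_def)
    moreover have "pverts H = pverts (chain_graph n)"
      unfolding eq by (simp add: chain_graph_def)
    ultimately show False
      using H by (auto intro: pair_pre_digraph.equality)
  qed
  with sub obtain k where "k \<le> n" "k \<notin> pverts H" by auto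
  with ind show "list_colorable H (restrict (chain_list n) (pverts H))"
    by (intro list_colorable_chain_delete_vertex)
qed

section \<open>Linked vertices and twins\<close>

lemma adj_mod3_neq: "adj p q \<Longrightarrow> p mod 3 \<noteq> q mod 3"
  by (auto simp: adj_def arc_up_def mod_Suc split: if_splits)

lemma adj_middle: "p mod 3 = 1 \<Longrightarrow> adj p q \<longleftrightarrow> q = p - 1 \<or> q = p + 1"
  by (cases p) (auto simp: adj_def arc_up_def)

lemma mod3_end: "(3 * j + 2) mod 3 = (2 :: nat)"
  by (simp add: mod_Suc)

lemma end_types_differ: "3 * i \<noteq> 3 * j + (2 :: nat)"
  using mod3_end[of j] by (metis mod_mult_self1_is_0 zero_neq_numeral)

lemma adj_ends: "adj (3 * i) (3 * j + 2) \<longleftrightarrow> i = Suc j \<or> i < j"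
  using mod3_end[of j] end_types_differ[of i j] unfolding adj_def arc_up_def by auto

text \<open>
  The half graph: among the vertices that are not middle vertices, adjacency together with twinship.
\<close>

definition linked :: "nat \<Rightarrow> nat \<Rightarrow> bool" where
  "linked p q \<longleftrightarrow> (\<exists>i j. i \<le> Suc j \<and> (p = 3 * i \<and> q = 3 * j + 2 \<or> q = 3 * i \<and> p = 3 * j + 2))"

definition twin :: "nat \<Rightarrow> nat \<Rightarrow> bool" where
  "twin p q \<longleftrightarrow> (\<exists>i. p = 3 * i \<and> q = 3 * i + 2 \<or> q = 3 * i \<and> p = 3 * i + 2)"

lemma linked_sym: "linked u v \<longleftrightarrow> linked v u"
  unfolding linked_def by blast

lemma twin_sym: "twin p q \<longleftrightarrow> twin q p"
  unfolding twin_def by blast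

lemma twin_unique:
  assumes "twin p q" "twin p r"
  shows "q = r"
  using assms end_types_differ unfolding twin_def by (elim exE disjE conjE) simp_all

lemma twin_imp_linked: "twin p q \<Longrightarrow> linked p q"
  unfolding linked_def twin_def using le_SucI by blast

lemma linked_end:
  "linked (3 * i) q \<longleftrightarrow> (\<exists>j. q = 3 * j + 2 \<and> i \<le> Suc j)"
  "linked (3 * j + 2) q \<longleftrightarrow> (\<exists>i. q = 3 * i \<and> i \<le> Suc j)"
proof -
  have *: "3 * i \<noteq> Suc (Suc (3 * j))" for i j :: nat
    using end_types_differ[of i j] by simp
  show "linked (3 * i) q \<longleftrightarrow> (\<exists>j. q = 3 * j + 2 \<and> i \<le> Suc j)"
    "linked (3 * j + 2) q \<longleftrightarrow> (\<exists>i. q = 3 * i \<and> i \<le> Suc j)"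
    unfolding linked_def using * *[symmetric] by auto
qed

lemma linked_ends: "linked (3 * i) (3 * j + 2) \<longleftrightarrow> i \<le> Suc j"
  unfolding linked_end by auto

lemma linked_endE:
  assumes "linked p q"
  obtains i j where "p = 3 * i" "q = 3 * j + 2" "i \<le> Suc j"
  | i j where "p = 3 * j + 2" "q = 3 * i" "i \<le> Suc j"
  using assms unfolding linked_def by blast

lemma linked_imp_twin_or_adj:
  assumes "linked p q"
  shows "twin p q \<or> adj p q"
proof -
  have "twin (3 * i) (3 * j + 2) \<or> adj (3 * i) (3 * j + 2)" if "i \<le> Suc j" for i j
  proof (cases "i = j")
    case False
    with that show ?thesis unfolding adj_ends by linarith
  qed (auto simp: twin_def)
  with assms show ?thesis
    by (elim linked_endE) (use twin_sym adj_sym in blast)+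
qed

lemma linked_mod3:
  assumes "linked p q"
  shows "p mod 3 = 0 \<and> q mod 3 = 2 \<or> p mod 3 = 2 \<and> q mod 3 = 0"
  using assms mod3_end by (elim linked_endE) simp_all

lemma adj_imp_linked:
  assumes "adj p q" "p mod 3 \<noteq> 1" "q mod 3 \<noteq> 1"
  shows "linked p q"
proof -
  have *: "linked p q" if "adj p q" "p mod 3 = 0" "q mod 3 = 2" for p q
  proof -
    have "p = 3 * (p div 3)" "q = 3 * (q div 3) + 2"
      using that mult_div_mod_eq[of 3 p] mult_div_mod_eq[of 3 q] by simp_all
    with that(1) adj_ends[of "p div 3" "q div 3"] show ?thesis
      unfolding linked_def by (metis le_SucI less_or_eq_imp_le)
  qed
  have "p mod 3 < 3" "q mod 3 < 3" by simp_all
  then have "p mod 3 = 0 \<and> q mod 3 = 2 \<or> p mod 3 = 2 \<and> q mod 3 = 0"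
    using assms adj_mod3_neq[of p q] by linarith
  moreover from assms(1) have "adj q p" by (auto simp: adj_def)
  ultimately show ?thesis
    using *[of p q] *[of q p] assms(1) linked_sym[of p q] by argo
qed

text \<open>
  The neighbourhood of a middle vertex is a pair of twins. This is how a middle vertex in an induced
  path keeps twins away from the rest of the path.
\<close>

lemma adj_middle_iff_twin:
  assumes "p mod 3 = 1" "adj p q"
  shows "adj p r \<longleftrightarrow> r = q \<or> twin q r"
proof -
  have p: "p = 3 * (p div 3) + 1"
    using assms(1) mult_div_mod_eq[of 3 p] by simp
  then have adj: "adj p r \<longleftrightarrow> r = 3 * (p div 3) \<or> r = 3 * (p div 3) + 2" for r
    unfolding adj_middle[OF assms(1)] by linarith
  have "twin (3 * (p div 3)) (3 * (p div 3) + 2)"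
    unfolding twin_def by blast
  then show ?thesis
    using assms(2) twin_unique twin_sym unfolding adj by metis
qed

lemma middle_unique:
  assumes "p mod 3 = 1" "p' mod 3 = 1" "adj p q" "adj p' q"
  shows "p = p'"
proof -
  have "p = 3 * (p div 3) + 1" "p' = 3 * (p' div 3) + 1"
    using assms(1,2) mult_div_mod_eq[of 3 p] mult_div_mod_eq[of 3 p'] by simp_all
  moreover have "q = p - 1 \<or> q = p + 1" "q = p' - 1 \<or> q = p' + 1"
    using assms adj_middle by blast+
  moreover have "3 * (p div 3) \<noteq> 3 * (p' div 3) + 2" "3 * (p' div 3) \<noteq> 3 * (p div 3) + 2"
    using end_types_differ by blast+
  ultimately show ?thesis by linarith
qed

lemma twin_not_adj:
  assumes "twin p q"
  shows "\<not> adj p q"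
proof -
  have "\<not> adj (3 * i) (3 * i + 2)" for i
    unfolding adj_ends by simp
  moreover from this have "\<not> adj (3 * i + 2) (3 * i)" for i
    unfolding adj_def by blast
  ultimately show ?thesis
    using assms unfolding twin_def by metis
qed

text \<open>
  Neighbourhoods in a half graph are nested, so of two links with ends \<open>u\<close> and \<open>w\<close> on the same side
  the larger neighbourhood contains both of the other ends.
\<close>

lemma linked_no_2K2:
  assumes "linked u v" "linked w z" "u mod 3 = w mod 3"
  shows "linked u z \<or> linked w v"
  using assms(1)
proof (cases rule: linked_endE)
  case (1 i j)
  with assms mod3_end obtain k l where "w = 3 * k" "z = 3 * l + 2" "k \<le> Suc l"
    by (elim linked_endE[of w z]) simp_all
  moreover have "i \<le> Suc l \<or> k \<le> Suc j"
    using \<open>i \<le> Suc j\<close> \<open>k \<le> Suc l\<close> by linarith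
  ultimately show ?thesis
    using 1 linked_ends by blast
next
  case (2 i j)
  with assms mod3_end obtain k l where "w = 3 * l + 2" "z = 3 * k" "k \<le> Suc l"
    by (elim linked_endE[of w z]) simp_all
  moreover have "i \<le> Suc l \<or> k \<le> Suc j"
    using \<open>i \<le> Suc j\<close> \<open>k \<le> Suc l\<close> by linarith
  ultimately show ?thesis
    using 2 linked_ends linked_sym by blast
qed

lemma linked_walk_mod3_eq: "linked u v \<Longrightarrow> linked v w \<Longrightarrow> u mod 3 = w mod 3"
  using linked_mod3[of u v] linked_mod3[of v w] by linarith

text \<open>
  The links \<open>w1 w2\<close> and \<open>w5 w4\<close> force a link between \<open>w1\<close> and \<open>w4\<close> or between \<open>w5\<close> and \<open>w2\<close>,
  and a link without an edge joins twins.
\<close>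

lemma linked_walk_5_twin:
  assumes "linked w1 w2" "linked w2 w3" "linked w3 w4" "linked w4 w5"
    and "\<not> adj w1 w4" "\<not> adj w2 w5"
  shows "twin w1 w4 \<or> twin w2 w5"
proof -
  have "w1 mod 3 = w5 mod 3"
    using assms linked_walk_mod3_eq by metis
  then have "linked w1 w4 \<or> linked w5 w2"
    using assms linked_sym by (intro linked_no_2K2) blast+
  then show ?thesis
    using assms(5,6) linked_imp_twin_or_adj linked_sym by metis
qed

text \<open>
  The situation of the next lemma with \<open>w2 = a\<^sub>i\<close> and \<open>w5 = c\<^sub>i\<close>: the remaining vertices are squeezed
  to \<open>w1 = c\<^sub>i\<^sub>-\<^sub>1\<close>, \<open>w3 = c\<^sub>i\<^sub>+\<^sub>1\<close>, \<open>w4 = a\<^sub>i\<^sub>-\<^sub>1\<close>, \<open>w6 = a\<^sub>i\<^sub>+\<^sub>1\<close>. The other orientation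
  follows by reading the six vertices backwards.
\<close>

lemma linked_walk_6_outer_twins:
  assumes l: "linked (3 * i) w1" "linked (3 * i) w3" "linked (3 * i + 2) w4" "linked (3 * i + 2) w6"
    and n: "\<not> adj w4 w1" "\<not> adj w6 w3" "\<not> adj w6 w1"
    and d: "distinct [w1, w3, 3 * i + 2]" "distinct [w4, w6, 3 * i]"
  shows "twin w1 w4 \<and> twin w3 w6"
proof -
  obtain a b c d where w: "w1 = 3 * a + 2" "w3 = 3 * b + 2" "w4 = 3 * c" "w6 = 3 * d"
    and le: "i \<le> Suc a" "i \<le> Suc b" "c \<le> Suc i" "d \<le> Suc i"
    using l unfolding linked_end by blast
  from w n have na: "c \<noteq> Suc a" "\<not> c < a" "d \<noteq> Suc b" "\<not> d < b" "d \<noteq> Suc a" "\<not> d < a"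
    using adj_ends[of c a] adj_ends[of d b] adj_ends[of d a] by blast+
  from w d have ne: "a \<noteq> b" "a \<noteq> i" "b \<noteq> i" "c \<noteq> d" "c \<noteq> i" "d \<noteq> i"
    by auto
  have d: "d = Suc i"
  proof (rule ccontr)
    assume "d \<noteq> Suc i"
    then have "d < i" using le(4) ne(6) by linarith
    then have "a = b" using na le(1,2) by linarith
    with ne(1) show False by simp
  qed
  then have "c < i" using le(3) ne(4,5) by linarith
  then have "a = c" using na(2) le(1) by linarith
  moreover have "b = d" using \<open>c < i\<close> \<open>a = c\<close> d na(4) le(2) le(1) ne(1,3) by linarith
  ultimately have "a = c \<and> b = d" ..
  then show ?thesis
    unfolding twin_def w by blast
qed

text \<open>
  If \<open>w2\<close> and \<open>w5\<close> were not twins, then \<open>w1\<close> would be a twin of \<open>w4\<close> by the five-vertex argument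
  and of \<open>w6\<close> because the links \<open>w1 w2\<close> and \<open>w5 w6\<close> also force a link across; but twins are unique. The
  outer pairs then follow.
\<close>

lemma linked_walk_6_twins:
  assumes l: "linked w1 w2" "linked w2 w3" "linked w3 w4" "linked w4 w5" "linked w5 w6"
    and n: "\<not> adj w1 w4" "\<not> adj w2 w5" "\<not> adj w3 w6" "\<not> adj w1 w6"
    and d: "distinct [w1, w2, w3, w4, w5, w6]"
  shows "twin w1 w4 \<and> twin w2 w5 \<and> twin w3 w6"
proof -
  have "w1 mod 3 = w5 mod 3"
    using l linked_walk_mod3_eq by metis
  then have "linked w1 w6 \<or> linked w5 w2"
    using l by (intro linked_no_2K2) simp_all
  then have "twin w1 w6 \<or> twin w2 w5"
    using n linked_imp_twin_or_adj linked_sym by metis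
  moreover have "twin w1 w4 \<or> twin w2 w5" "twin w2 w5 \<or> twin w3 w6"
    using linked_walk_5_twin[of w1 w2 w3 w4 w5] linked_walk_5_twin[of w2 w3 w4 w5 w6] l n by auto
  moreover have "w4 \<noteq> w6" using d by simp
  ultimately have t: "twin w2 w5"
    using twin_unique by blast
  then obtain i where "w2 = 3 * i \<and> w5 = 3 * i + 2 \<or> w5 = 3 * i \<and> w2 = 3 * i + 2"
    unfolding twin_def by blast
  then have "twin w1 w4 \<and> twin w3 w6 \<or> twin w6 w3 \<and> twin w4 w1"
  proof (elim disjE conjE)
    assume "w2 = 3 * i" "w5 = 3 * i + 2"
    then show ?thesis
      using linked_walk_6_outer_twins[of i w1 w3 w4 w6] l n d linked_sym adj_sym by auto
  next
    assume "w5 = 3 * i" "w2 = 3 * i + 2"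
    then show ?thesis
      using linked_walk_6_outer_twins[of i w6 w4 w3 w1] l n d linked_sym adj_sym by auto
  qed
  with t show ?thesis using twin_sym by blast
qed

section \<open>No triangle\<close>

lemma adj_no_triangle:
  assumes "adj p q" "adj q r" "adj p r"
  shows False
proof -
  have no: False if "p mod 3 = 1" "adj p q" "adj p r" "adj q r" for p q r
  proof -
    have "q \<noteq> r" using adj_mod3_neq[OF that(4)] by blast
    then have "twin q r" using that adj_middle_iff_twin[of p q r] by auto
    then show False using twin_not_adj[of q r] that(4) by auto
  qed
  have "p mod 3 < 3" "q mod 3 < 3" "r mod 3 < 3" by simp_all
  then have "p mod 3 = 1 \<or> q mod 3 = 1 \<or> r mod 3 = 1"
    using adj_mod3_neq[OF assms(1)] adj_mod3_neq[OF assms(2)] adj_mod3_neq[OF assms(3)] by linarith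
  then show False
    using no[of p q r] no[of q p r] no[of r p q] assms by (auto simp: adj_def)
qed

section \<open>No induced path on eight vertices\<close>

lemma no_induced_path_8:
  assumes inj: "inj_on x {..<8}"
    and adj: "\<And>j k. j < 8 \<Longrightarrow> k < 8 \<Longrightarrow> adj (x j) (x k) \<longleftrightarrow> k = Suc j \<or> j = Suc k"
  shows False
proof -
  \<comment> \<open>\<open>b k\<close>: position \<open>k\<close> holds a middle vertex; \<open>ws\<close>: the positions that remain when these are
    deleted; \<open>nxt\<close>: the relation between successive entries of \<open>ws\<close>.\<close>
  define b where "b k \<longleftrightarrow> x k mod 3 = 1" for k :: nat
  define nxt where "nxt k l \<longleftrightarrow> k < l \<and> l < 8 \<and> linked (x k) (x l) \<and> (l = k + 1 \<or> l = k + 2 \<and> b (k + 1))" for k l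
  define ws where "ws = filter (\<lambda>k. \<not> b k) [0..<8]"
  have x_eq: "x j = x k \<longleftrightarrow> j = k" if "j < 8" "k < 8" for j k
    using inj that by (auto dest: inj_onD)
  have skip: "twin (x k) (x (k + 2))" if "b (k + 1)" "k + 2 < 8" for k
    using that adj_middle_iff_twin[of "x (k + 1)" "x k" "x (k + 2)"] adj[of "k + 1"] x_eq[of "k + 2" k]
    by (auto simp: b_def)
  have not_bb: "\<not> (b k \<and> b (k + 1))" if "k + 1 < 8" for k
    using adj[of k "k + 1"] adj_mod3_neq[of "x k" "x (k + 1)"] that by (auto simp: b_def)
  have not_bxb: "\<not> (b k \<and> b (k + 2))" if "k + 2 < 8" for k
  proof
    assume bb: "b k \<and> b (k + 2)"
    then have "x k = x (k + 2)"
      using that adj[of k "k + 1"] adj[of "k + 2" "k + 1"]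
        middle_unique[of "x k" "x (k + 2)" "x (k + 1)"] by (auto simp: b_def)
    with x_eq[of k "k + 2"] that show False by simp
  qed
  have nxt1: "nxt k (k + 1)" if "\<not> b k" "\<not> b (k + 1)" "k + 1 < 8" for k
    using that adj[of k "k + 1"] adj_imp_linked[of "x k" "x (k + 1)"] unfolding nxt_def b_def by auto
  have nxt2: "nxt k (k + 2)" if "b (k + 1)" "k + 2 < 8" for k
    using that twin_imp_linked[OF skip[OF that]] unfolding nxt_def by auto
  \<comment> \<open>The second conjunct locates the last remaining position before \<open>j\<close>, from which the next step is made.\<close>
  have "successively nxt (filter (\<lambda>k. \<not> b k) [0..<j]) \<and>
    (\<forall>k ks. filter (\<lambda>k. \<not> b k) [0..<j] = ks @ [k] \<longrightarrow> j = k + 1 \<or> j = k + 2 \<and> b (k + 1))" if "j \<le> 8" for j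
    using that
  proof (induction j)
    case (Suc j)
    show ?case
    proof (cases "b j")
      case True
      have "Suc j = k + 2 \<and> b (k + 1)" if "filter (\<lambda>k. \<not> b k) [0..<j] = ks @ [k]" for k ks
        using Suc that True not_bb[of "k + 1"] by auto
      with Suc True show ?thesis by auto
    next
      case False
      have "nxt (last (filter (\<lambda>k. \<not> b k) [0..<j])) j" if "filter (\<lambda>k. \<not> b k) [0..<j] \<noteq> []"
      proof -
        from that obtain ks k where ks: "filter (\<lambda>k. \<not> b k) [0..<j] = ks @ [k]"
          by (metis rev_exhaust)
        then have "k \<in> set (filter (\<lambda>k. \<not> b k) [0..<j])" by simp
        then have "\<not> b k" by simp
        with Suc ks False nxt1[of k] nxt2[of k] show ?thesis by auto
      qed
      with Suc False show ?thesis by (auto simp: successively_append_iff)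
    qed
  qed simp
  then have succ: "successively nxt ws" unfolding ws_def by blast
  \<comment> \<open>Any three consecutive positions contain at most one middle vertex, and so do the last two.\<close>
  have upt: "[0..<8] = [0, 1, 2] @ [3, 4, 5] @ [6, 7 :: nat]"
    by (simp add: upt_rec)
  have "2 \<le> length (filter (\<lambda>k. \<not> b k) [0, 1, 2])" "2 \<le> length (filter (\<lambda>k. \<not> b k) [3, 4, 5])"
    "1 \<le> length (filter (\<lambda>k. \<not> b k) [6, 7])"
    using not_bb[of 0] not_bb[of 1] not_bxb[of 0] not_bb[of 3] not_bb[of 4] not_bxb[of 3] not_bb[of 6]
    by (auto simp: numeral_2_eq_2)
  then have len: "5 \<le> length ws"
    unfolding ws_def upt filter_append length_append by linarith
  have set_ws: "m \<in> set ws \<longleftrightarrow> m < 8 \<and> \<not> b m" for m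
    unfolding ws_def by auto
  \<comment> \<open>Twins too far apart to be the two neighbours of a middle vertex on the path; neither of them
    lies next to one at all.\<close>
  define far where "far k l \<longleftrightarrow> twin (x k) (x l) \<and> k + 3 \<le> l \<and> l < 8" for k l
  have free: "\<not> b m" if "far k l \<or> far l k" "m < 8" "m = k + 1 \<or> k = m + 1" for k l m
  proof
    assume "b m"
    moreover have kl: "twin (x k) (x l)" "k < 8" "l < 8"
      using that(1) twin_sym[of "x k" "x l"] by (auto simp: far_def)
    moreover have "adj (x m) (x k)"
      using that(2,3) kl(2) adj[of m k] by auto
    ultimately have "adj (x m) (x l)"
      using adj_middle_iff_twin[of "x m" "x k" "x l"] by (auto simp: b_def)
    then have "l = m + 1 \<or> m = l + 1"
      using adj[of m l] that(2) kl(3) by auto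
    with that(1,3) show False by (auto simp: far_def)
  qed
  have six: "twin (x k1) (x k4) \<and> twin (x k2) (x k5) \<and> twin (x k3) (x k6)"
    if "successively nxt [k1, k2, k3, k4, k5, k6]" for k1 k2 k3 k4 k5 k6
    using that by (intro linked_walk_6_twins) (auto simp: nxt_def adj x_eq)
  obtain k1 k2 k3 k4 k5 ks where ws: "ws = k1 # k2 # k3 # k4 # k5 # ks"
    using len by (auto simp: Suc_le_length_iff numeral_eq_Suc)
  show False
  proof (cases ks)
    case Nil
    with ws have k: "ws = [k1, k2, k3, k4, k5]" by simp
    with succ have n: "nxt k1 k2" "nxt k2 k3" "nxt k3 k4" "nxt k4 k5" by auto
    have inws: "m \<in> {k1, k2, k3, k4, k5}" if "m < 8" "\<not> b m" for m
      using set_ws[of m] that k by auto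
    from n have bd: "k1 < k2" "k2 < k3" "k3 < k4" "k4 < k5" "k5 < 8"
      by (auto simp: nxt_def)
    have "twin (x k1) (x k4) \<or> twin (x k2) (x k5)"
      using n bd by (intro linked_walk_5_twin[of _ _ "x k3"]) (auto simp: nxt_def adj)
    then have "far k1 k4 \<or> far k2 k5"
      using bd by (auto simp: far_def)
    \<comment> \<open>With no middle vertex beside the first and fourth remaining position, the five positions end
      at \<open>5\<close> or earlier, which leaves middle vertices side by side at \<open>6\<close> and \<open>7\<close>; the other case is
      symmetric.\<close>
    moreover have False if "far k1 k4"
    proof -
      have f: "\<not> b m" if "m < 8" "m = l + 1 \<or> l = m + 1" "l \<in> {k1, k4}" for m l
        using that free \<open>far k1 k4\<close> by blast
      have "k1 = 0"
      proof (rule ccontr)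
        assume "k1 \<noteq> 0"
        then have "\<not> b (k1 - 1)" using f[of "k1 - 1" k1] bd by simp
        then have "k1 - 1 \<in> {k1, k2, k3, k4, k5}" using inws[of "k1 - 1"] bd by simp
        with \<open>k1 \<noteq> 0\<close> bd show False by simp linarith
      qed
      moreover have "k2 = k1 + 1" "k4 = k3 + 1" "k5 = k4 + 1" "k3 \<le> k2 + 2"
        using n f[of "k1 + 1" k1] f[of "k3 + 1" k4] f[of "k4 + 1" k4] bd by (auto simp: nxt_def)
      ultimately have "b 6" "b 7" using inws[of 6] inws[of 7] bd by auto
      then show False using not_bb[of 6] by simp
    qed
    moreover have False if "far k2 k5"
    proof -
      have f: "\<not> b m" if "m < 8" "m = l + 1 \<or> l = m + 1" "l \<in> {k2, k5}" for m l
        using that free \<open>far k2 k5\<close> by blast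
      have "k5 = 7" using f[of "k5 + 1" k5] inws[of "k5 + 1"] bd by (cases "k5 < 7") auto
      moreover have "k2 = k1 + 1" "k3 = k2 + 1" "k5 = k4 + 1" "k4 \<le> k3 + 2"
        using n f[of "k1 + 1" k2] f[of "k2 + 1" k2] f[of "k4 + 1" k5] bd by (auto simp: nxt_def)
      ultimately have "b 0" "b 1" using inws[of 0] inws[of 1] bd by auto
      then show False using not_bb[of 0] by simp
    qed
    ultimately show False by blast
  next
    case (Cons k6 ks')
    with ws have k: "ws = k1 # k2 # k3 # k4 # k5 # k6 # ks'" by simp
    with succ have n: "successively nxt [k1, k2, k3, k4, k5, k6]" by auto
    then have bd: "k1 < k2" "k2 < k3" "k3 < k4" "k4 < k5" "k5 < k6" "k6 < 8"
      by (auto simp: nxt_def)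
    note t = six[OF n]
    then have far: "far k1 k4" "far k2 k5" "far k3 k6"
      using bd by (auto simp: far_def)
    have fr: "\<not> b m" if "l \<in> {k1, k2, k3, k4, k5, k6}" "m < 8" "m = l + 1 \<or> l = m + 1" for l m
    proof -
      from that(1) far obtain l' where "far l l' \<or> far l' l" by blast
      then show ?thesis using free that(2,3) by blast
    qed
    \<comment> \<open>All six vertices have far twins, so no middle vertex of the path is next to any of them.\<close>
    have consec: "k2 = k1 + 1" "k3 = k1 + 2" "k4 = k1 + 3" "k5 = k1 + 4" "k6 = k1 + 5"
      using n bd fr[of k1 "k1 + 1"] fr[of k2 "k2 + 1"] fr[of k3 "k3 + 1"] fr[of k4 "k4 + 1"] fr[of k5 "k5 + 1"]
      by (auto simp: nxt_def)
    show False
    proof (cases ks')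
      case Nil
      with k have set: "m \<in> {k1, k2, k3, k4, k5, k6}" if "m < 8" "\<not> b m" for m
        using set_ws[of m] that by auto
      have "k1 = 0"
      proof (rule ccontr)
        assume "k1 \<noteq> 0"
        then have "\<not> b (k1 - 1)" using fr[of k1 "k1 - 1"] bd by simp
        then have "k1 - 1 \<in> {k1, k2, k3, k4, k5, k6}" using set[of "k1 - 1"] bd by simp
        with \<open>k1 \<noteq> 0\<close> bd show False by simp linarith
      qed
      moreover have "k6 = 7" using set[of "k6 + 1"] fr[of k6 "k6 + 1"] bd by (cases "k6 < 7") auto
      ultimately show False using consec by simp
    next
      case (Cons k7 ks'')
      with succ k have n': "successively nxt [k2, k3, k4, k5, k6, k7]" by auto
      then have "k6 < k7" "k7 < 8" by (auto simp: nxt_def)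
      moreover have "x k1 = x k7"
        using six[OF n'] t twin_sym[of "x k1" "x k4"] twin_unique[of "x k4" "x k1" "x k7"] by blast
      ultimately show False using x_eq[of k1 k7] bd by simp
    qed
  qed
qed

lemma graph_free_chain: "graph_free {path_graph 8, cycle_graph 3} (chain_graph n)"
proof (rule graph_freeI)
  fix H :: "nat pair_pre_digraph" and f
  assume "H \<in> {path_graph 8, cycle_graph 3}" and inj: "inj_on f (pverts H)"
    and sub: "f ` pverts H \<subseteq> pverts (chain_graph n)"
    and arcs: "\<And>i j. i \<in> pverts H \<Longrightarrow> j \<in> pverts H \<Longrightarrow>
      (f i, f j) \<in> parcs (chain_graph n) \<longleftrightarrow> (i, j) \<in> parcs H"
  then consider "H = path_graph 8" | "H = cycle_graph 3" by blast
  then show False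
  proof cases
    case 1
    show False
    proof (rule no_induced_path_8[of f])
      show "inj_on f {..<8}"
        using inj 1 by (simp add: path_graph_def)
      show "adj (f j) (f k) \<longleftrightarrow> k = Suc j \<or> j = Suc k" if "j < 8" "k < 8" for j k
        using arcs[of j k] sub that 1 by (auto simp: path_graph_def chain_graph_def)
    qed
  next
    case 2
    have "adj (f 0) (f 1)" "adj (f 1) (f 2)" "adj (f 0) (f 2)"
      using arcs[of 0 1] arcs[of 1 2] arcs[of 0 2] 2 by (auto simp: cycle_graph_def chain_graph_def)
    then show False by (rule adj_no_triangle)
  qed
qed

section \<open>Infinitely many obstructions\<close>

theorem theorem1p7:
  shows "infinite ({(G :: nat pair_pre_digraph, L).
           minimal_list3_obstruction G L \<and> graph_free {path_graph 8, cycle_graph 3} G} // list3_iso)"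
    (is "infinite (?S // _)")
proof -
  let ?I = "\<lambda>n. (chain_graph (Suc n), chain_list (Suc n))"
  have mem: "list3_iso `` {?I n} \<in> ?S // list3_iso" for n
    using minimal_list3_obstruction_chain[of "Suc n"] graph_free_chain by (intro quotientI) simp
  have "inj (\<lambda>n. list3_iso `` {?I n})"
  proof (rule injI)
    fix m n
    assume "list3_iso `` {?I m} = list3_iso `` {?I n}"
    then have "(?I m, ?I n) \<in> list3_iso"
      by (rule eq_equiv_class[OF _ equiv_list3_iso]) (simp add: list3_instance_chain)
    then have "card (pverts (chain_graph (Suc m))) = card (pverts (chain_graph (Suc n)))"
      unfolding list3_iso_iff by (metis card_image)
    then show "m = n" by (simp add: chain_graph_def)
  qed
  then have "infinite (range (\<lambda>n. list3_iso `` {?I n}))"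
    by (rule range_inj_infinite)
  moreover have "range (\<lambda>n. list3_iso `` {?I n}) \<subseteq> ?S // list3_iso"
    by (intro image_subsetI mem)
  ultimately show ?thesis
    by (rule infinite_super[rotated])
qed

end
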